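(* Let $L$ be a modular lattice. Then $\operatorname{Dim}L$ is a conical refinement monoid.
   Context: For a lattice $L$, the dimension monoid $\operatorname{Dim}L$ is the commutative monoid defined by generators $\Delta(a,b)$ (for $a\leq b$ in $L$) and the relations: (D0) $\Delta(a,a)=0$ for all $a\in L$; (D1) $\Delta(a,c)=\Delta(a,b)+\Delta(b,c)$ for all $a\leq b\leq c$ in $L$; (D2) $\Delta(a,a\vee b)=\Delta(a\wedge b,b)$ for all $a,b\in L$. (The lattice is not assumed to be bounded.) A commutative monoid $M$ is conical if $x+y=0$ implies $x=y=0$, for all $x,y\in M$. It is a refinement monoid if whenever $a_0+a_1=b_0+b_1$ in $M$, there are $c_{ij}\in M$ ($i,j<2$) such that $a_i=c_{i0}+c_{i1}$ and $b_i=c_{0i}+c_{1i}$ for all $i<2$. *)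

theory Defs
  imports "HOL-Library.Multiset"
begin

class modular_lattice = lattice +
  assumes modular_law: "a \<le> c \<Longrightarrow> sup a (inf b c) = inf (sup a b) c"

text \<open>The set of symbols \<open>\<Delta>(a,b)\<close> with \<open>a \<le> b\<close>.\<close>

typedef (overloaded) 'a ordered_pair = "{(a :: 'a::lattice, b). a \<le> b}"
  by auto

text \<open>Outside \<open>a \<le> b\<close> the value of \<open>gen a b\<close> is unspecified, so it is only used under that guard.\<close>

definition gen :: "'a::lattice \<Rightarrow> 'a \<Rightarrow> 'a ordered_pair"
  where "gen a b = Abs_ordered_pair (a, b)"

text \<open>The free commutative monoid on a set of generators is the type of finite multisets.
  The following is the smallest monoid congruence on it containing (D0), (D1) and (D2).\<close>

inductive dim_cong :: "'a::lattice ordered_pair multiset \<Rightarrow> 'a ordered_pair multiset \<Rightarrow> bool" where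
  D0: "dim_cong {# gen a a #} {#}"
| D1: "a \<le> b \<Longrightarrow> b \<le> c \<Longrightarrow> dim_cong {# gen a c #} ({# gen a b #} + {# gen b c #})"
| D2: "dim_cong {# gen a (sup a b) #} {# gen (inf a b) b #}"
| refl: "dim_cong X X"
| sym: "dim_cong X Y \<Longrightarrow> dim_cong Y X"
| trans: "dim_cong X Y \<Longrightarrow> dim_cong Y Z \<Longrightarrow> dim_cong X Z"
| add: "dim_cong X Y \<Longrightarrow> dim_cong X' Y' \<Longrightarrow> dim_cong (X + X') (Y + Y')"

quotient_type (overloaded) 'a dim = "'a::lattice ordered_pair multiset" / dim_cong
  by (intro equivpI reflpI sympI transpI) (auto intro: dim_cong.refl dim_cong.sym dim_cong.trans)

instantiation dim :: (lattice) comm_monoid_add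
begin

lift_definition zero_dim :: "'a dim" is "{#}" .

lift_definition plus_dim :: "'a dim \<Rightarrow> 'a dim \<Rightarrow> 'a dim" is "(+)"
  by (rule dim_cong.add)

instance
  by standard (transfer; simp add: ac_simps dim_cong.refl)+

end

lift_definition Delta :: "'a::lattice \<Rightarrow> 'a \<Rightarrow> 'a dim" is "\<lambda>a b. {# gen a b #}" .

lemma Delta_D0: "Delta a a = 0"
  by transfer (rule dim_cong.D0)

lemma Delta_D1: "a \<le> b \<Longrightarrow> b \<le> c \<Longrightarrow> Delta a c = Delta a b + Delta b c"
  by transfer (rule dim_cong.D1)

lemma Delta_D2: "Delta a (sup a b) = Delta (inf a b) b"
  by transfer (rule dim_cong.D2)

definition conical :: "'m::comm_monoid_add itself \<Rightarrow> bool" where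
  "conical _ \<longleftrightarrow> (\<forall>x y :: 'm. x + y = 0 \<longrightarrow> x = 0 \<and> y = 0)"

definition refinement_monoid :: "'m::comm_monoid_add itself \<Rightarrow> bool" where
  "refinement_monoid _ \<longleftrightarrow>
    (\<forall>a0 a1 b0 b1 :: 'm. a0 + a1 = b0 + b1 \<longrightarrow>
      (\<exists>c00 c01 c10 c11.
        a0 = c00 + c01 \<and> a1 = c10 + c11 \<and>
        b0 = c00 + c10 \<and> b1 = c01 + c11))"

end

theory Submission
  imports Defs "HOL-Library.Confluence"
begin

text \<open>
  The relations (D0), (D1), (D2) are read as rewriting rules on finite multisets of intervals: a
  trivial interval may be deleted, an interval may be cut in two at an intermediate point, and an
  interval may be replaced by a projective one, that is, by one reached from it through finitely
  many transpositions between \<open>[a, a \<squnion> b]\<close> and \<open>[a \<sqinter> b, b]\<close>. Every rule rewrites a \<^emph>\<open>single\<close>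
  interval, so the result of rewriting a sum \<open>X + Y\<close> is a sum of a result of rewriting \<open>X\<close> and a
  result of rewriting \<open>Y\<close>.

  The heart of the matter is that, over a modular lattice, the rewriting is confluent
  (\<open>confluentp_rewrite\<close>). Two facts give this. First, the modular law makes transposition an
  isomorphism of intervals, so a cut of an interval can be copied to any projective interval, with
  projective pieces (\<open>projective_cut\<close>). Second, two cuts of the same interval have refinements
  whose pieces are pairwise projective, which is the smallest case of the Schreier refinement
  theorem (\<open>schreier_cut\<close>). If on each interval one cut followed by arbitrary projectivities
  counts as a single step, and all intervals of the multiset are rewritten simultaneously, then
  these facts say that the step relation has the diamond property (\<open>rewrite_diamond\<close>). Deletions do
  no harm, as intervals obtained from a trivial one are again trivial and can be deleted too.

  By confluence, two multisets represent the same element of the dimension monoid if and only if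
  they rewrite to a common multiset (\<open>dim_cong_iff_joinable\<close>). If \<open>a0 + a1 = b0 + b1\<close>, a common
  result of rewriting both sides is a sum in two ways, and the refinement property of the free
  commutative monoid provides the refinement matrix. If \<open>x + y = 0\<close>, the common result is empty, as
  nothing but the empty multiset arises from the empty multiset; so \<open>x\<close> and \<open>y\<close> rewrite to the
  empty multiset as well.
\<close>

section \<open>Intervals and projectivity\<close>

lemma gen_eq_iff: "a \<le> b \<Longrightarrow> c \<le> d \<Longrightarrow> gen a b = gen c d \<longleftrightarrow> a = c \<and> b = d"
  by (simp add: gen_def Abs_ordered_pair_inject)

inductive projective :: "'a::lattice ordered_pair \<Rightarrow> 'a ordered_pair \<Rightarrow> bool" where
  refl: "projective x x"
| up: "projective x (gen (inf a b) b) \<Longrightarrow> projective x (gen a (sup a b))"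
| down: "projective x (gen a (sup a b)) \<Longrightarrow> projective x (gen (inf a b) b)"

lemma projective_trans:
  assumes "projective y z" and "projective x y"
  shows "projective x z"
  using assms by (induction) (auto intro: projective.intros)

lemma projective_transpose:
  "projective (gen (inf a b) b) (gen a (sup a b))"
  "projective (gen a (sup a b)) (gen (inf a b) b)"
  by (auto intro: projective.intros)

lemma projective_sym: "projective x y \<Longrightarrow> projective y x"
  by (induction rule: projective.induct)
    (auto intro: projective.refl projective_trans projective_transpose)

lemma projective_transposeI:
  assumes "s = sup a b" "i = inf a b"
  shows "projective (gen i b) (gen a s)"
  using projective_transpose assms by blast

lemma projective_dim_cong: "projective x y \<Longrightarrow> dim_cong {#x#} {#y#}"
  by (induction rule: projective.induct)
    (blast intro: dim_cong.refl dim_cong.trans[OF _ dim_cong.D2]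
      dim_cong.trans[OF _ dim_cong.sym[OF dim_cong.D2]])+

text \<open>
  Transposition carries the least point of an interval to the least point and the greatest to the
  greatest, so an interval with one point stays one.
\<close>

lemma projective_trivial:
  assumes "projective x y" "x = gen a a"
  obtains b where "y = gen b b"
proof -
  have "\<exists>b. y = gen b b"
    using assms
  proof (induction)
    case refl
    then show ?case by blast
  next
    case (up x a b)
    then obtain c where "gen (inf a b) b = gen c c" by blast
    then have "inf a b = b" by (metis gen_eq_iff inf.cobounded2 order.refl)
    then have "b \<le> a" by (metis inf.cobounded1)
    then show ?case by (metis sup.absorb1)
  next
    case (down x a b)
    then obtain c where "gen a (sup a b) = gen c c" by blast
    then have "sup a b = a" by (metis gen_eq_iff sup.cobounded1 order.refl)
    then have "b \<le> a" by (metis sup.cobounded2)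
    then show ?case by (metis inf.absorb2)
  qed
  then show thesis using that by blast
qed

section \<open>Copying cuts along projectivities\<close>

inductive cut :: "'a::lattice ordered_pair \<Rightarrow> 'a ordered_pair \<Rightarrow> 'a ordered_pair \<Rightarrow> bool" where
  "a \<le> b \<Longrightarrow> b \<le> c \<Longrightarrow> cut (gen a c) (gen a b) (gen b c)"

lemma cut_genE:
  assumes "cut (gen a c) y z" "a \<le> c"
  obtains b where "a \<le> b" "b \<le> c" "y = gen a b" "z = gen b c"
  using assms(1)
proof cases
  case (1 a' b c')
  then have "a' = a" "c' = c"
    using gen_eq_iff[of a c a' c'] assms(2) by (auto intro: order_trans)
  then show thesis
    using 1 that by blast
qed

text \<open>
  The transposition maps between \<open>[a, a \<squnion> b]\<close> and \<open>[a \<sqinter> b, b]\<close> are \<open>c \<mapsto> c \<sqinter> b\<close> and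
  \<open>d \<mapsto> a \<squnion> d\<close>. The modular law enters through \<open>a \<squnion> (b \<sqinter> c) = c\<close> in one
  direction and \<open>(a \<squnion> d) \<sqinter> b = d\<close> in the other; these make
  the pieces themselves transposes of each other.
\<close>

lemma projective_cut:
  fixes x :: "'a::modular_lattice ordered_pair"
  assumes "projective x y" "cut x x1 x2"
  obtains y1 y2 where "cut y y1 y2" "projective x1 y1" "projective x2 y2"
proof -
  have "\<exists>y1 y2. cut y y1 y2 \<and> projective x1 y1 \<and> projective x2 y2"
    using assms
  proof (induction)
    case (refl x)
    then show ?case by (blast intro: projective.refl)
  next
    case (up x a b)
    then obtain y1 y2 where y: "cut (gen (inf a b) b) y1 y2" "projective x1 y1" "projective x2 y2"
      by blast
    obtain d where d: "inf a b \<le> d" "d \<le> b" "y1 = gen (inf a b) d" "y2 = gen d b"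
      using y(1) by (rule cut_genE) auto
    have low: "inf a b = inf a d"
      using d(1,2) by (intro order.antisym) (auto intro: le_infI2)
    have mid: "d = inf (sup a d) b"
      using modular_law[of d b a] d by (simp add: sup.absorb1 sup.commute)
    have top: "sup a b = sup (sup a d) b"
      using d(2) by (simp add: sup.assoc sup.absorb2)
    have "projective y1 (gen a (sup a d))"
      unfolding d by (rule projective_transposeI) (use low in auto)
    moreover have "projective y2 (gen (sup a d) (sup a b))"
      unfolding d by (rule projective_transposeI) (use mid top in auto)
    moreover have "cut (gen a (sup a b)) (gen a (sup a d)) (gen (sup a d) (sup a b))"
      by (rule cut.intros) (use d in \<open>auto intro: le_supI2\<close>)
    ultimately show ?case
      using y by (blast intro: projective_trans)
  next
    case (down x a b)
    then obtain y1 y2 where y: "cut (gen a (sup a b)) y1 y2" "projective x1 y1" "projective x2 y2"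
      by blast
    obtain c where c: "a \<le> c" "c \<le> sup a b" "y1 = gen a c" "y2 = gen c (sup a b)"
      using y(1) by (rule cut_genE) auto
    have low: "inf a b = inf a (inf c b)"
      using c(1) by (simp add: inf.assoc[symmetric] inf.absorb1)
    have mid: "c = sup a (inf c b)"
      using modular_law[of a c b] c by (simp add: inf.absorb1 inf.commute)
    have top: "sup a b = sup c b"
      using c by (intro order.antisym) (auto intro: le_supI1)
    have "projective (gen (inf a b) (inf c b)) y1"
      unfolding c by (rule projective_transposeI) (use low mid in auto)
    moreover have "projective (gen (inf c b) b) y2"
      unfolding c by (rule projective_transposeI) (use top in auto)
    moreover have "cut (gen (inf a b) b) (gen (inf a b) (inf c b)) (gen (inf c b) b)"
      by (rule cut.intros) (use c in \<open>auto intro: le_infI1\<close>)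
    ultimately show ?case
      using y by (blast intro: projective_trans projective_sym)
  qed
  then show thesis using that by blast
qed

section \<open>Rewriting a single interval\<close>

text \<open>
  Projectivities after a cut belong to the same step: the two sides of a Schreier refinement agree
  only up to transposition, and a diamond closing in one step on either side must absorb that.
\<close>

inductive rewrite1 :: "'a::lattice ordered_pair \<Rightarrow> 'a ordered_pair multiset \<Rightarrow> bool" where
  trivial: "rewrite1 (gen a a) {#}"
| move: "projective x y \<Longrightarrow> rewrite1 x {#y#}"
| cut: "cut x y z \<Longrightarrow> projective y y' \<Longrightarrow> projective z z' \<Longrightarrow> rewrite1 x {#y', z'#}"

lemma rewrite1_dim_cong:
  assumes "rewrite1 x Y"
  shows "dim_cong {#x#} Y"
  using assms
proof cases
  case trivial
  then show ?thesis by (simp add: dim_cong.D0)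
next
  case (move y)
  then show ?thesis by (simp add: projective_dim_cong)
next
  case (cut y z y' z')
  have "dim_cong {#x#} ({#y#} + {#z#})"
    using cut(2) by cases (auto dest: dim_cong.D1)
  moreover have "dim_cong ({#y#} + {#z#}) ({#y'#} + {#z'#})"
    using cut by (intro dim_cong.add projective_dim_cong)
  ultimately have "dim_cong {#x#} ({#y'#} + {#z'#})"
    by (rule dim_cong.trans)
  then show ?thesis
    using cut(1) by (simp add: add_mset_commute)
qed

text \<open>
  A rewriting of an interval is available, with literally the same result, from every projective
  interval; hence only the rewritings of one representative need to be compared below.
\<close>

lemma rewrite1_projective:
  fixes x :: "'a::modular_lattice ordered_pair"
  assumes "rewrite1 x Y" "projective x x'"
  shows "rewrite1 x' Y"
  using assms(1)
proof cases
  case (trivial a)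
  then show ?thesis
    using assms(2) by (metis projective_trivial rewrite1.trivial)
next
  case (move y)
  then show ?thesis
    using assms(2) by (blast intro: rewrite1.move projective_trans projective_sym)
next
  case (cut y z y' z')
  obtain u v where "cut x' u v" "projective y u" "projective z v"
    using projective_cut[OF assms(2) cut(2)] by blast
  then show ?thesis
    using cut by (blast intro: rewrite1.cut projective_trans projective_sym)
qed

section \<open>Simultaneous rewriting of multisets\<close>

inductive rewrite :: "'a::lattice ordered_pair multiset \<Rightarrow> 'a ordered_pair multiset \<Rightarrow> bool" where
  empty: "rewrite {#} {#}"
| add: "rewrite1 x Y \<Longrightarrow> rewrite X X' \<Longrightarrow> rewrite (add_mset x X) (Y + X')"

lemma rewrite_refl: "rewrite X X"
proof (induction X)
  case empty
  show ?case by (rule rewrite.empty)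
next
  case (add x X)
  then show ?case
    using rewrite.add[OF rewrite1.move[OF projective.refl]] by fastforce
qed

lemma rewrite_single: "rewrite1 x Y \<Longrightarrow> rewrite {#x#} Y"
  using rewrite.add[OF _ rewrite.empty] by fastforce

lemma rewrite_plus: "rewrite X X' \<Longrightarrow> rewrite Y Y' \<Longrightarrow> rewrite (X + Y) (X' + Y')"
proof (induction rule: rewrite.induct)
  case empty
  then show ?case by simp
next
  case (add x Z X X')
  then show ?case
    using rewrite.add[of x Z "X + Y" "X' + Y'"] by (simp add: add.assoc)
qed

text \<open>This holds because each rule has a single interval on its left-hand side.\<close>

lemma rewrite_plusE:
  assumes "rewrite (X + Y) Z"
  obtains X' Y' where "Z = X' + Y'" "rewrite X X'" "rewrite Y Y'"
proof -
  have "\<exists>X' Y'. Z = X' + Y' \<and> rewrite X X' \<and> rewrite Y Y'"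
    using assms
  proof (induction "X + Y" Z arbitrary: X Y rule: rewrite.induct)
    case empty
    then show ?case by (auto intro: rewrite.empty)
  next
    case (add x V U U')
    have "x \<in># X + Y" by (metis add.hyps(4) union_single_eq_member)
    then consider "x \<in># X" | "x \<in># Y" by auto
    then show ?case
    proof cases
      case 1
      then obtain X0 where X: "X = add_mset x X0" by (metis insert_DiffM)
      with add.hyps(4) have "U = X0 + Y" by simp
      then obtain X' Y' where "U' = X' + Y'" "rewrite X0 X'" "rewrite Y Y'"
        using add.hyps(3) by blast
      then show ?thesis
        using add.hyps(1) X by (metis add.assoc rewrite.add)
    next
      case 2
      then obtain Y0 where Y: "Y = add_mset x Y0" by (metis insert_DiffM)
      with add.hyps(4) have "U = X + Y0" by simp
      then obtain X' Y' where "U' = X' + Y'" "rewrite X X'" "rewrite Y0 Y'"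
        using add.hyps(3) by blast
      then show ?thesis
        using add.hyps(1) Y by (metis union_lcomm rewrite.add)
    qed
  qed
  then show thesis using that by blast
qed

lemma rewrite_emptyD: "rewrite {#} Y \<Longrightarrow> Y = {#}"
  by (auto elim: rewrite.cases)

lemma rewrite_singleD: "rewrite {#x#} Y \<Longrightarrow> rewrite1 x Y"
  by (auto elim!: rewrite.cases dest!: rewrite_emptyD)

lemma rewrite_dim_cong: "rewrite X Y \<Longrightarrow> dim_cong X Y"
proof (induction rule: rewrite.induct)
  case empty
  show ?case by (rule dim_cong.refl)
next
  case (add x Y X X')
  then show ?case
    using dim_cong.add[OF rewrite1_dim_cong] by fastforce
qed

section \<open>Confluence\<close>

text \<open>
  Cutting \<open>[a, c]\<close> at \<open>b\<close> and at \<open>d\<close>, one cuts the four pieces further at \<open>b \<sqinter> d\<close> or \<open>b \<squnion> d\<close>. The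
  outer pieces \<open>[a, b \<sqinter> d]\<close> and \<open>[b \<squnion> d, c]\<close> then occur on both sides, and the inner ones match
  crosswise: \<open>[b \<sqinter> d, b]\<close> is a transpose of \<open>[d, b \<squnion> d]\<close>, and \<open>[b \<sqinter> d, d]\<close> one of
  \<open>[b, b \<squnion> d]\<close>.
\<close>

lemma schreier_cut:
  fixes x :: "'a::modular_lattice ordered_pair"
  assumes "cut x y z" "cut x y' z'"
  obtains p q r s where
    "rewrite1 y {#p, q#}" "rewrite1 z {#r, s#}" "rewrite1 y' {#p, r#}" "rewrite1 z' {#q, s#}"
proof -
  obtain a b c where x: "a \<le> b" "b \<le> c" "x = gen a c" "y = gen a b" "z = gen b c"
    using assms(1) by (auto elim: cut.cases)
  have "a \<le> c" using x by auto
  then obtain d where d: "a \<le> d" "d \<le> c" "y' = gen a d" "z' = gen d c"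
    using assms(2) unfolding x by (blast elim: cut_genE)
  let ?p = "gen a (inf b d)" and ?q = "gen (inf b d) b"
  let ?r = "gen (inf b d) d" and ?s = "gen (sup b d) c"
  have "rewrite1 y {#?p, ?q#}"
    unfolding x
    by (rule rewrite1.cut[OF cut.intros[of a "inf b d" b] projective.refl projective.refl])
      (use x d in auto)
  moreover have "rewrite1 z {#?r, ?s#}"
    unfolding x
    by (rule rewrite1.cut[OF cut.intros[of b "sup b d" c] projective_transpose(2) projective.refl])
      (use x d in auto)
  moreover have "rewrite1 y' {#?p, ?r#}"
    unfolding d
    by (rule rewrite1.cut[OF cut.intros[of a "inf b d" d] projective.refl projective.refl])
      (use x d in auto)
  moreover have "rewrite1 z' {#?q, ?s#}"
    unfolding d
    by (rule rewrite1.cut[OF cut.intros[of d "sup b d" c] _ projective.refl])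
      (use x d projective_transpose(2)[of d b] in \<open>auto simp: inf.commute sup.commute\<close>)
  ultimately show thesis by (rule that)
qed

lemma rewrite1_trivialD:
  fixes a :: "'a::modular_lattice"
  assumes "rewrite1 (gen a a) Z"
  shows "rewrite Z {#}"
  using assms
proof cases
  case trivial
  then show ?thesis by (simp add: rewrite_refl)
next
  case (move y)
  then show ?thesis
    by (metis projective_trivial rewrite1.trivial rewrite_single)
next
  case (cut y z y' z')
  then have "y = gen a a" "z = gen a a"
    by (auto elim!: cut_genE dest: order.antisym)
  then obtain b c where "y' = gen b b" "z' = gen c c"
    using cut(3,4) by (metis projective_trivial)
  then show ?thesis
    using rewrite_plus[OF rewrite_single[OF rewrite1.trivial] rewrite_single[OF rewrite1.trivial]]
      cut(1) by (metis add.right_neutral add_mset_add_single union_mset_add_mset_left)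
qed

lemma rewrite1_diamond:
  fixes x :: "'a::modular_lattice ordered_pair"
  assumes Y: "rewrite1 x Y" and Z: "rewrite1 x Z"
  shows "\<exists>W. rewrite Y W \<and> rewrite Z W"
  using Y
proof cases
  case (trivial a)
  then show ?thesis
    using Z by (blast intro: rewrite1_trivialD rewrite_refl)
next
  case (move y)
  then show ?thesis
    using Z by (blast intro: rewrite_refl rewrite_single rewrite1_projective)
next
  case cutY: (cut y1 y2 y1' y2')
  show ?thesis
    using Z
  proof cases
    case (trivial a)
    then show ?thesis
      using Y by (blast intro: rewrite1_trivialD rewrite_refl)
  next
    case (move z)
    then show ?thesis
      using Y by (blast intro: rewrite_refl rewrite_single rewrite1_projective)
  next
    case cutZ: (cut z1 z2 z1' z2')
    obtain p q r s where
      "rewrite1 y1 {#p, q#}" "rewrite1 y2 {#r, s#}" "rewrite1 z1 {#p, r#}" "rewrite1 z2 {#q, s#}"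
      using schreier_cut[OF cutY(2) cutZ(2)] by blast
    then have "rewrite {#y1'#} {#p, q#}" "rewrite {#y2'#} {#r, s#}"
      and "rewrite {#z1'#} {#p, r#}" "rewrite {#z2'#} {#q, s#}"
      using cutY(3,4) cutZ(3,4) by (blast intro: rewrite_single rewrite1_projective)+
    then have "rewrite ({#y1'#} + {#y2'#}) ({#p, q#} + {#r, s#})"
      and "rewrite ({#z1'#} + {#z2'#}) ({#p, r#} + {#q, s#})"
      by (blast intro: rewrite_plus)+
    moreover have "{#p, r#} + {#q, s#} = {#p, q#} + {#r, s#}"
      by simp
    ultimately show ?thesis
      unfolding cutY(1) cutZ(1) by (auto simp: add_mset_commute)
  qed
qed

lemma rewrite_diamond:
  fixes X :: "'a::modular_lattice ordered_pair multiset"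
  assumes "rewrite X Y" "rewrite X Z"
  shows "\<exists>W. rewrite Y W \<and> rewrite Z W"
  using assms
proof (induction X arbitrary: Y Z)
  case empty
  then show ?case by (metis rewrite_emptyD)
next
  case (add x X)
  obtain Y1 Y2 where Y: "Y = Y1 + Y2" "rewrite {#x#} Y1" "rewrite X Y2"
    using add.prems(1) rewrite_plusE[of "{#x#}" X Y] by auto
  obtain Z1 Z2 where Z: "Z = Z1 + Z2" "rewrite {#x#} Z1" "rewrite X Z2"
    using add.prems(2) rewrite_plusE[of "{#x#}" X Z] by auto
  obtain W1 where "rewrite Y1 W1" "rewrite Z1 W1"
    using rewrite1_diamond Y(2) Z(2) by (blast dest: rewrite_singleD)
  moreover obtain W2 where "rewrite Y2 W2" "rewrite Z2 W2"
    using add.IH Y(3) Z(3) by blast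
  ultimately show ?case
    unfolding Y(1) Z(1) by (blast intro: rewrite_plus)
qed

lemma confluentp_rewrite:
  "confluentp (rewrite :: 'a::modular_lattice ordered_pair multiset \<Rightarrow> _)"
proof (rule strong_confluentp_imp_confluentp, rule strong_confluentpI)
  fix X Y Z :: "'a ordered_pair multiset"
  assume "rewrite X Y" "rewrite X Z"
  then obtain W where "rewrite Y W" "rewrite Z W"
    using rewrite_diamond by blast
  then show "\<exists>W. rewrite\<^sup>*\<^sup>* Y W \<and> rewrite\<^sup>=\<^sup>= Z W"
    by blast
qed

section \<open>Equality in the dimension monoid\<close>

lemma rewrites_plus:
  assumes "rewrite\<^sup>*\<^sup>* X X'" "rewrite\<^sup>*\<^sup>* Y Y'"
  shows "rewrite\<^sup>*\<^sup>* (X + Y) (X' + Y')"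
proof -
  have "rewrite\<^sup>*\<^sup>* (X + Y) (X' + Y)"
    using assms(1)
    by induction (auto intro: rtranclp.rtrancl_into_rtrancl rewrite_plus rewrite_refl)
  moreover have "rewrite\<^sup>*\<^sup>* (X' + Y) (X' + Y')"
    using assms(2)
    by induction (auto intro: rtranclp.rtrancl_into_rtrancl rewrite_plus rewrite_refl)
  ultimately show ?thesis by (rule rtranclp_trans)
qed

lemma rewrites_plusE:
  assumes "rewrite\<^sup>*\<^sup>* (X + Y) Z"
  obtains X' Y' where "Z = X' + Y'" "rewrite\<^sup>*\<^sup>* X X'" "rewrite\<^sup>*\<^sup>* Y Y'"
proof -
  have "\<exists>X' Y'. Z = X' + Y' \<and> rewrite\<^sup>*\<^sup>* X X' \<and> rewrite\<^sup>*\<^sup>* Y Y'"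
    using assms
    by induction (blast, metis rewrite_plusE rtranclp.rtrancl_into_rtrancl)
  then show thesis using that by blast
qed

lemma rewrites_emptyD: "rewrite\<^sup>*\<^sup>* {#} Y \<Longrightarrow> Y = {#}"
  by (induction rule: rtranclp_induct) (simp_all add: rewrite_emptyD)

lemma rewrites_dim_cong: "rewrite\<^sup>*\<^sup>* X Y \<Longrightarrow> dim_cong X Y"
proof (induction rule: rtranclp_induct)
  case base
  show ?case by (rule dim_cong.refl)
next
  case (step Y Z)
  then show ?case by (metis rewrite_dim_cong dim_cong.trans)
qed

text \<open>
  Joinability contains the defining relations and is compatible with addition because rewriting is;
  what confluence adds is transitivity.
\<close>

lemma dim_cong_iff_joinable:
  fixes X :: "'a::modular_lattice ordered_pair multiset"
  shows "dim_cong X Y \<longleftrightarrow> (\<exists>Z. rewrite\<^sup>*\<^sup>* X Z \<and> rewrite\<^sup>*\<^sup>* Y Z)"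
proof
  assume "dim_cong X Y"
  then show "\<exists>Z. rewrite\<^sup>*\<^sup>* X Z \<and> rewrite\<^sup>*\<^sup>* Y Z"
  proof induction
    case (D0 a)
    show ?case by (blast intro: rewrite_single rewrite1.trivial)
  next
    case (D1 a b c)
    then have "rewrite {#gen a c#} {#gen a b, gen b c#}"
      by (blast intro: rewrite_single rewrite1.cut cut.intros projective.refl)
    then have "rewrite {#gen a c#} ({#gen a b#} + {#gen b c#})"
      by (simp add: add_mset_commute)
    then show ?case by blast
  next
    case (D2 a b)
    show ?case by (blast intro: rewrite_single rewrite1.move projective_transpose)
  next
    case (refl X)
    show ?case by blast
  next
    case (sym X Y)
    then show ?case by blast
  next
    case (trans X Y Z)
    then obtain U V where "rewrite\<^sup>*\<^sup>* X U" "rewrite\<^sup>*\<^sup>* Y U" "rewrite\<^sup>*\<^sup>* Y V" "rewrite\<^sup>*\<^sup>* Z V"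
      by blast
    moreover from this obtain W where "rewrite\<^sup>*\<^sup>* U W" "rewrite\<^sup>*\<^sup>* V W"
      using confluentpD[OF confluentp_rewrite] by blast
    ultimately show ?case by (blast intro: rtranclp_trans)
  next
    case (add X Y X' Y')
    then show ?case by (blast intro: rewrites_plus)
  qed
next
  assume "\<exists>Z. rewrite\<^sup>*\<^sup>* X Z \<and> rewrite\<^sup>*\<^sup>* Y Z"
  then obtain Z where "dim_cong X Z" "dim_cong Y Z"
    by (blast intro: rewrites_dim_cong)
  then show "dim_cong X Y"
    by (metis dim_cong.sym dim_cong.trans)
qed

section \<open>Conicality and refinement\<close>

text \<open>
  \<open>c00\<close> is taken as large as possible, namely the intersection of \<open>a0\<close> and \<open>b0\<close>; the other three
  entries are then forced.
\<close>

lemma refinement_monoid_multiset: "refinement_monoid TYPE('b multiset)"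
  unfolding refinement_monoid_def
proof (intro allI impI)
  fix a0 a1 b0 b1 :: "'b multiset"
  assume eq: "a0 + a1 = b0 + b1"
  have count: "count a0 x + count a1 x = count b0 x + count b1 x" for x
    using eq by (metis count_union)
  have "a0 = (a0 \<inter># b0) + (a0 - b0)" "b0 = (a0 \<inter># b0) + (b0 - a0)"
    by (auto simp: multiset_eq_iff)
  moreover have "a1 = (b0 - a0) + (a1 - (b0 - a0))"
  proof (rule multiset_eqI)
    show "count a1 x = count ((b0 - a0) + (a1 - (b0 - a0))) x" for x
      using count[of x] by simp
  qed
  moreover have "b1 = (a0 - b0) + (a1 - (b0 - a0))"
  proof (rule multiset_eqI)
    show "count b1 x = count ((a0 - b0) + (a1 - (b0 - a0))) x" for x
      using count[of x] by simp
  qed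
  ultimately show "\<exists>c00 c01 c10 c11. a0 = c00 + c01 \<and> a1 = c10 + c11 \<and>
      b0 = c00 + c10 \<and> b1 = c01 + c11"
    by blast
qed

lemma conical_dim: "conical TYPE('a::modular_lattice dim)"
proof -
  have "dim_cong X {#} \<and> dim_cong Y {#}" if eq: "dim_cong (X + Y) {#}"
    for X Y :: "'a ordered_pair multiset"
  proof -
    obtain Z where "rewrite\<^sup>*\<^sup>* (X + Y) Z" "rewrite\<^sup>*\<^sup>* {#} Z"
      using eq unfolding dim_cong_iff_joinable by blast
    moreover from this have "Z = {#}"
      by (blast dest: rewrites_emptyD)
    ultimately obtain X' Y' where "{#} = X' + Y'" "rewrite\<^sup>*\<^sup>* X X'" "rewrite\<^sup>*\<^sup>* Y Y'"
      by (blast elim: rewrites_plusE)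
    then have "rewrite\<^sup>*\<^sup>* X {#}" "rewrite\<^sup>*\<^sup>* Y {#}"
      by simp_all
    then show ?thesis by (blast intro: rewrites_dim_cong)
  qed
  then show ?thesis
    unfolding conical_def by transfer blast
qed

lemma refinement_monoid_dim: "refinement_monoid TYPE('a::modular_lattice dim)"
proof -
  have "\<exists>C00 C01 C10 C11. dim_cong A0 (C00 + C01) \<and> dim_cong A1 (C10 + C11) \<and>
      dim_cong B0 (C00 + C10) \<and> dim_cong B1 (C01 + C11)"
    if eq: "dim_cong (A0 + A1) (B0 + B1)" for A0 A1 B0 B1 :: "'a ordered_pair multiset"
  proof -
    obtain W where "rewrite\<^sup>*\<^sup>* (A0 + A1) W" "rewrite\<^sup>*\<^sup>* (B0 + B1) W"
      using eq unfolding dim_cong_iff_joinable by blast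
    obtain A0' A1' where A: "W = A0' + A1'" "rewrite\<^sup>*\<^sup>* A0 A0'" "rewrite\<^sup>*\<^sup>* A1 A1'"
      using \<open>rewrite\<^sup>*\<^sup>* (A0 + A1) W\<close> by (rule rewrites_plusE)
    obtain B0' B1' where B: "W = B0' + B1'" "rewrite\<^sup>*\<^sup>* B0 B0'" "rewrite\<^sup>*\<^sup>* B1 B1'"
      using \<open>rewrite\<^sup>*\<^sup>* (B0 + B1) W\<close> by (rule rewrites_plusE)
    have "A0' + A1' = B0' + B1'"
      using A(1) B(1) by simp
    then obtain C00 C01 C10 C11 where
      "A0' = C00 + C01" "A1' = C10 + C11" "B0' = C00 + C10" "B1' = C01 + C11"
      using refinement_monoid_multiset unfolding refinement_monoid_def by blast
    then show ?thesis
      using A(2,3) B(2,3) by (blast intro: rewrites_dim_cong)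
  qed
  then show ?thesis
    unfolding refinement_monoid_def by transfer blast
qed

theorem theorem5p4:
  shows "conical TYPE('a::modular_lattice dim) \<and> refinement_monoid TYPE('a dim)"
  using conical_dim refinement_monoid_dim by blast

end
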